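(* Let $\mathbf I=([0,1],d)$, where $d(x,y)=|x-y|$ is the Euclidean metric, and let $\mathfrak I_1=([0,1],d^* )$, where $d^*$ is the metric obtained from the $L$-$R$ symbol sequences of the dyadic map (defined in the context). Then $\mathfrak I_1$ is an ultracontinuum of $\mathbf I$.
   Context: A continuum is a compact, connected metric space with uncountably many elements. $(X,d^* )$ is an ultracontinuum of $(X,d)$ if and only if $(X,d)$ is a continuum and the metric topology of $(X,d^* )$ is strictly finer than the metric topology of $(X,d)$. $Q$ is the set of all infinite one-sided sequences over the alphabet $\{L,R\}$ that do not end in an infinite string of $R$'s, together with the single sequence $RRRR\dots$. (This is the set of itineraries, with respect to $L=[0,\frac12)$ and $R=[\frac12,1]$, of points of $[0,1]$ under the dyadic map $f(x)=2x$ for $0\le x<\frac12$, $f(x)=2x-1$ for $\frac12\le x\le1$.) The metric $\ell$ on $Q$ is $\ell(x,y)=2^{-k}$ if $x\ne y$, where $k$ is the length of the longest prefix shared by $x$ and $y$, and $\ell(x,x)=0$. The bijection $h:Q\to[0,1]$ is given by $h(s_1s_2s_3\dots)=\sum_{i\ge1} b_i2^{-i}$ with $b_i=0$ if $s_i=L$ and $b_i=1$ if $s_i=R$. The metric $d^*$ on $[0,1]$ is $d^*(x,y)=\ell(h^{-1}(x),h^{-1}(y))$. *)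

theory Defs
  imports "HOL-Analysis.Abstract_Metric_Spaces" "HOL-Library.Countable_Set"
begin

definition continuum :: "'a set \<Rightarrow> ('a \<Rightarrow> 'a \<Rightarrow> real) \<Rightarrow> bool" where
  "continuum X d \<longleftrightarrow>
     Metric_space X d \<and>
     compact_space (Metric_space.mtopology X d) \<and>
     connected_space (Metric_space.mtopology X d) \<and>
     uncountable X"

(* Reads: (X, d') is an ultracontinuum of (X, d). *)
definition ultracontinuum ::
    "'a set \<Rightarrow> ('a \<Rightarrow> 'a \<Rightarrow> real) \<Rightarrow> ('a \<Rightarrow> 'a \<Rightarrow> real) \<Rightarrow> bool" where
  "ultracontinuum X d' d \<longleftrightarrow>
     continuum X d \<and>
     Metric_space X d' \<and>
     {U. openin (Metric_space.mtopology X d) U} \<subset> {U. openin (Metric_space.mtopology X d') U}"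

datatype symbol = L | R

(* Sequences are indexed from 0, so s i is the (i+1)-st symbol of the itinerary. *)
definition itineraries :: "(nat \<Rightarrow> symbol) set" where
  "itineraries = {s. \<not> (\<exists>N. \<forall>n\<ge>N. s n = R)} \<union> {\<lambda>_. R}"

(* For x \<noteq> y the set of lengths of shared prefixes is finite and contains 0, so GREATEST is
   its maximum. *)
definition shared_prefix_length :: "(nat \<Rightarrow> symbol) \<Rightarrow> (nat \<Rightarrow> symbol) \<Rightarrow> nat" where
  "shared_prefix_length x y = (GREATEST k. \<forall>i<k. x i = y i)"

definition ell :: "(nat \<Rightarrow> symbol) \<Rightarrow> (nat \<Rightarrow> symbol) \<Rightarrow> real" where
  "ell x y = (if x = y then 0 else 1 / 2 ^ shared_prefix_length x y)"

fun digit :: "symbol \<Rightarrow> real" where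
  "digit L = 0"
| "digit R = 1"

definition h :: "(nat \<Rightarrow> symbol) \<Rightarrow> real" where
  "h s = (\<Sum>i. digit (s i) / 2 ^ Suc i)"

(* h maps itineraries bijectively onto [0,1], so on [0,1] the function inv_into itineraries h
   is its inverse. Outside [0,1] the values of dstar are unspecified, but still nonnegative and
   symmetric, as Metric_space requires of a distance on the whole type. *)
definition dstar :: "real \<Rightarrow> real \<Rightarrow> real" where
  "dstar x y = ell (inv_into itineraries h x) (inv_into itineraries h y)"

end

theory Submission
  imports Defs "HOL-Analysis.Continuum_Not_Denumerable"
begin

text \<open>
  Two itineraries with a common prefix of length \<open>n\<close> are mapped by \<open>h\<close> to points at
  Euclidean distance at most \<open>2\<^sup>-\<^sup>n\<close>. Hence the Euclidean metric is dominated by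
  \<open>d\<^sup>*\<close>, and every Euclidean open set is \<open>d\<^sup>*\<close>-open. The points whose itineraries
  start with \<open>L\<close> and those whose itineraries start with \<open>R\<close> form two \<open>d\<^sup>*\<close>-open sets which
  separate \<open>[0,1]\<close>, so by connectedness they are not both open in the Euclidean topology.
\<close>

section \<open>The metric on symbol sequences\<close>

text \<open>\<open>GREATEST\<close> is only meaningful on a bounded nonempty set: 0 always belongs
  to it, and any index where \<open>x\<close> and \<open>y\<close> differ bounds it. The equivalence
  follows because the predicate is closed downwards.\<close>

lemma le_shared_prefix_length_iff:
  assumes "x \<noteq> y"
  shows "n \<le> shared_prefix_length x y \<longleftrightarrow> (\<forall>i<n. x i = y i)"
proof -
  obtain m where m: "x m \<noteq> y m" using assms by blast
  let ?P = "\<lambda>k. \<forall>i<k. x i = y i"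
  have bound: "k \<le> m" if "?P k" for k using that m by (meson not_le)
  have "?P (shared_prefix_length x y)"
    unfolding shared_prefix_length_def
    by (rule GreatestI_nat[where P = ?P and k = 0 and b = m]) (use bound in auto)
  moreover have "k \<le> shared_prefix_length x y" if "?P k" for k
    unfolding shared_prefix_length_def
    by (rule Greatest_le_nat[where P = ?P and b = m]) (use bound that in auto)
  ultimately show ?thesis by (meson less_le_trans)
qed

text \<open>Closed balls of radius \<open>1 / 2 ^ n\<close> are cylinders, so later distance
  estimates become statements about prefixes.\<close>

lemma ell_le_iff: "ell x y \<le> 1 / 2 ^ n \<longleftrightarrow> (\<forall>i<n. x i = y i)"
  by (cases "x = y") (simp_all add: ell_def divide_simps le_shared_prefix_length_iff)

lemma ell_nonneg: "0 \<le> ell x y"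
  by (simp add: ell_def)

lemma ell_commute: "ell x y = ell y x"
  by (simp add: ell_def shared_prefix_length_def eq_commute)

lemma ell_eq_0_iff: "ell x y = 0 \<longleftrightarrow> x = y"
  by (simp add: ell_def)

lemma ell_cases: "x = y \<or> (\<exists>n. ell x y = 1 / 2 ^ n)"
  by (auto simp: ell_def)

text \<open>Prefixes shared by \<open>x\<close>, \<open>y\<close> and by \<open>y\<close>,
  \<open>z\<close> are both shared by \<open>x\<close>, \<open>z\<close> up to the shorter of the
  two lengths.\<close>

lemma ell_ultrametric: "ell x z \<le> max (ell x y) (ell y z)"
proof (cases "x = y \<or> y = z")
  case True
  then show ?thesis by auto
next
  case False
  then obtain a b where ab: "ell x y = 1 / 2 ^ a" "ell y z = 1 / 2 ^ b"
    using ell_cases by metis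
  then have "\<forall>i<a. x i = y i" "\<forall>i<b. y i = z i"
    by (metis ell_le_iff order_refl)+
  then have "ell x z \<le> 1 / 2 ^ min a b"
    by (simp add: ell_le_iff)
  then show ?thesis
    using ab by (auto simp: min_def split: if_splits)
qed

section \<open>The coding map\<close>

lemma digit_bounds: "0 \<le> digit c" "digit c \<le> 1"
  by (cases c; simp)+

lemma half_sums: "(\<lambda>n. 1 / 2 ^ Suc n :: real) sums 1"
  using power_half_series by (simp add: power_divide)

lemma summable_digits: "summable (\<lambda>i. digit (s i) / 2 ^ Suc i)"
  by (rule summable_comparison_test'[OF sums_summable[OF half_sums], of 0])
     (simp add: digit_bounds divide_simps)

lemma h_nonneg: "0 \<le> h s"
  unfolding h_def by (rule suminf_nonneg[OF summable_digits]) (simp add: digit_bounds)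

text \<open>The complementary digits form a nonnegative series; this gives
  \<open>h s \<le> 1\<close>, with equality only when every term vanishes.\<close>

lemma one_minus_h_sums: "(\<lambda>i. (1 - digit (s i)) / 2 ^ Suc i) sums (1 - h s)"
  using sums_diff[OF half_sums summable_sums[OF summable_digits[of s]]]
  by (simp add: h_def diff_divide_distrib)

lemma h_le_1: "h s \<le> 1"
  using sums_le[OF _ sums_zero one_minus_h_sums[of s]] by (simp add: digit_bounds)

lemma h_eq_1_iff: "h s = 1 \<longleftrightarrow> (\<forall>i. s i = R)"
proof -
  have "h s = 1 \<longleftrightarrow> (\<Sum>i. (1 - digit (s i)) / 2 ^ Suc i) = 0"
    by (simp only: sums_unique[OF one_minus_h_sums[of s], symmetric]) auto
  also have "\<dots> \<longleftrightarrow> (\<forall>i. (1 - digit (s i)) / 2 ^ Suc i = 0)"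
    by (rule suminf_eq_zero_iff[OF sums_summable[OF one_minus_h_sums]])
       (simp add: digit_bounds)
  also have "\<dots> \<longleftrightarrow> (\<forall>i. s i = R)"
  proof -
    have "(1 - digit c) / 2 ^ Suc i = 0 \<longleftrightarrow> c = R" for c i by (cases c) simp_all
    then show ?thesis by simp
  qed
  finally show ?thesis .
qed

text \<open>Self-similarity of the coding: the remainder after \<open>n\<close> symbols is again a
  value of \<open>h\<close>, hence in [0,1], scaled down.\<close>

lemma h_split: "h s = (\<Sum>i<n. digit (s i) / 2 ^ Suc i) + h (\<lambda>i. s (i + n)) / 2 ^ n"
proof -
  have "h s = (\<Sum>i. digit (s (i + n)) / 2 ^ Suc (i + n)) + (\<Sum>i<n. digit (s i) / 2 ^ Suc i)"
    unfolding h_def by (rule suminf_split_initial_segment[OF summable_digits])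
  also have "(\<Sum>i. digit (s (i + n)) / 2 ^ Suc (i + n)) = h (\<lambda>i. s (i + n)) / 2 ^ n"
    unfolding h_def suminf_divide[OF summable_digits, symmetric]
    by (simp add: power_add mult.assoc)
  finally show ?thesis by simp
qed

lemma h_dist_le:
  assumes "\<forall>i<n. x i = y i"
  shows "\<bar>h x - h y\<bar> \<le> 1 / 2 ^ n"
proof -
  have "h x - h y = (h (\<lambda>i. x (i + n)) - h (\<lambda>i. y (i + n))) / 2 ^ n"
    using h_split[of x n] h_split[of y n] assms by (simp add: diff_divide_distrib)
  moreover have "\<bar>h (\<lambda>i. x (i + n)) - h (\<lambda>i. y (i + n))\<bar> \<le> 1"
    using h_nonneg[of "\<lambda>i. x (i + n)"] h_nonneg[of "\<lambda>i. y (i + n)"]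
      h_le_1[of "\<lambda>i. x (i + n)"] h_le_1[of "\<lambda>i. y (i + n)"] by linarith
  ultimately show ?thesis by (simp add: divide_right_mono)
qed

lemma h_dist_le_ell: "\<bar>h x - h y\<bar> \<le> ell x y"
proof (cases "x = y")
  case True
  then show ?thesis by (simp add: ell_def)
next
  case False
  then obtain n where n: "ell x y = 1 / 2 ^ n" using ell_cases by blast
  then show ?thesis
    using h_dist_le ell_le_iff by (metis order_refl)
qed

text \<open>The ban on tails of \<open>R\<close> enters here; an \<open>L\<close> at position
  \<open>k\<close> rules out the exceptional constant sequence.\<close>

lemma itineraries_tail:
  assumes "s \<in> itineraries" "s k = L"
  shows "\<exists>i>k. s i = L"
proof (rule ccontr)
  assume "\<not> ?thesis"
  then have "\<forall>n\<ge>Suc k. s n = R" by (metis Suc_le_lessD symbol.exhaust)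
  then show False using assms by (auto simp: itineraries_def)
qed

text \<open>Strictness comes from a later \<open>L\<close> in \<open>x\<close>: its tail value stays
  below 1, whereas LRRR... and RLLL... would have the same image.\<close>

lemma h_less:
  assumes "x \<in> itineraries" "\<forall>i<k. x i = y i" "x k = L" "y k = R"
  shows "h x < h y"
proof -
  let ?S = "\<Sum>i<k. digit (x i) / 2 ^ Suc i"
  obtain i where i: "i > k" "x i = L" using itineraries_tail[OF assms(1,3)] by blast
  have "\<not> (\<forall>j. x (j + Suc k) = R)"
    using i by (metis less_iff_Suc_add add_Suc_right add.commute symbol.distinct(1))
  then have "h (\<lambda>j. x (j + Suc k)) < 1"
    using h_eq_1_iff h_le_1 by (metis less_eq_real_def)
  moreover have "h x = ?S + h (\<lambda>j. x (j + Suc k)) / 2 ^ Suc k"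
    using h_split[of x "Suc k"] assms(3) by simp
  ultimately have "h x < ?S + 1 / 2 ^ Suc k"
    by (simp add: divide_strict_right_mono)
  also have "\<dots> \<le> h y"
    using h_split[of y "Suc k"] assms h_nonneg[of "\<lambda>j. y (j + Suc k)"] by simp
  finally show ?thesis .
qed

lemma inj_on_h: "inj_on h itineraries"
proof (rule inj_onI, rule ccontr)
  fix x y assume *: "x \<in> itineraries" "y \<in> itineraries" "h x = h y" "x \<noteq> y"
  then have "\<exists>k. x k \<noteq> y k" by auto
  then obtain k where k: "x k \<noteq> y k" "\<forall>i<k. x i = y i"
    using exists_least_iff[of "\<lambda>k. x k \<noteq> y k"] by blast
  then have "h x < h y \<or> h y < h x"
    using h_less[of x k y] h_less[of y k x] *(1,2) by (cases "x k"; cases "y k") auto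
  with *(3) show False by simp
qed

text \<open>For \<open>0 \<le> x < 1\<close> the floor is the integer formed by the first
  \<open>i + 1\<close> binary digits of \<open>x\<close>, and its parity is the last of them. At
  \<open>x = 1\<close> all floors are even, so the endpoint is treated separately.\<close>

definition binary_itinerary :: "real \<Rightarrow> nat \<Rightarrow> symbol" where
  "binary_itinerary x i = (if odd \<lfloor>2 ^ Suc i * x\<rfloor> then R else L)"

text \<open>Rewrites the parity as a difference of floors, so that the weighted digit sums
  telescope.\<close>

lemma digit_binary_itinerary:
  "digit (binary_itinerary x n) = of_int \<lfloor>2 ^ Suc n * x\<rfloor> - 2 * of_int \<lfloor>2 ^ n * x\<rfloor>"
proof -
  define y where "y = 2 ^ n * x"
  have "\<lfloor>2 * y\<rfloor> = 2 * \<lfloor>y\<rfloor> \<or> \<lfloor>2 * y\<rfloor> = 2 * \<lfloor>y\<rfloor> + 1"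
    by linarith
  then show ?thesis
    by (auto simp: binary_itinerary_def y_def mult.assoc)
qed

lemma sum_binary_itinerary:
  assumes "0 \<le> x" "x < 1"
  shows "(\<Sum>i<n. digit (binary_itinerary x i) / 2 ^ Suc i) = of_int \<lfloor>2 ^ n * x\<rfloor> / 2 ^ n"
proof (induction n)
  case 0
  have "\<lfloor>x\<rfloor> = 0" using assms by linarith
  then show ?case by simp
next
  case (Suc n)
  then show ?case
    by (simp add: digit_binary_itinerary field_simps del: power_Suc) (simp add: field_simps)
qed

lemma h_binary_itinerary:
  assumes "0 \<le> x" "x < 1"
  shows "h (binary_itinerary x) = x"
proof -
  \<comment> \<open>Both numbers lie in the dyadic interval of length \<open>1 / 2 ^ n\<close> that
    starts at the truncation of \<open>x\<close>.\<close>
  have "\<bar>h (binary_itinerary x) - x\<bar> \<le> 1 / 2 ^ n" for n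
  proof -
    let ?t = "h (\<lambda>i. binary_itinerary x (i + n))"
    have "h (binary_itinerary x) = (of_int \<lfloor>2 ^ n * x\<rfloor> + ?t) / 2 ^ n"
      using h_split[of "binary_itinerary x" n] sum_binary_itinerary[OF assms, of n]
      by (simp add: add_divide_distrib)
    then have "h (binary_itinerary x) - x = (of_int \<lfloor>2 ^ n * x\<rfloor> + ?t - 2 ^ n * x) / 2 ^ n"
      by (simp add: field_simps)
    moreover have "\<bar>of_int \<lfloor>2 ^ n * x\<rfloor> + ?t - 2 ^ n * x\<bar> \<le> 1"
      using h_nonneg[of "\<lambda>i. binary_itinerary x (i + n)"]
        h_le_1[of "\<lambda>i. binary_itinerary x (i + n)"] by linarith
    ultimately show ?thesis by (simp add: divide_right_mono)
  qed
  moreover have "(\<lambda>n. 1 / 2 ^ n :: real) \<longlonglongrightarrow> 0"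
    using LIMSEQ_power_zero[of "1/2 :: real"] by (simp add: power_divide)
  ultimately have "\<bar>h (binary_itinerary x) - x\<bar> \<le> 0"
    by (intro LIMSEQ_le_const) auto
  then show ?thesis by simp
qed

text \<open>If all digits from position \<open>N\<close> on were \<open>R\<close>, the tail would contribute
  the full \<open>2\<^sup>-\<^sup>N\<close>, although the truncation error \<open>x - \<lfloor>2\<^sup>N x\<rfloor> / 2\<^sup>N\<close> is smaller.\<close>

lemma binary_itinerary_in:
  assumes "0 \<le> x" "x < 1"
  shows "binary_itinerary x \<in> itineraries"
proof -
  have False if "\<forall>n\<ge>N. binary_itinerary x n = R" for N
  proof -
    have "h (\<lambda>i. binary_itinerary x (i + N)) = 1"
      using that by (simp add: h_eq_1_iff)
    then have "x = (of_int \<lfloor>2 ^ N * x\<rfloor> + 1) / 2 ^ N"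
      using h_split[of "binary_itinerary x" N] sum_binary_itinerary[OF assms, of N]
        h_binary_itinerary[OF assms] by (simp add: add_divide_distrib)
    then have "2 ^ N * x = of_int \<lfloor>2 ^ N * x\<rfloor> + 1"
      by (simp add: field_simps)
    then show False by linarith
  qed
  then show ?thesis by (auto simp: itineraries_def)
qed

lemma bij_betw_h: "bij_betw h itineraries {0..1}"
  unfolding bij_betw_def
proof (intro conjI inj_on_h subset_antisym subsetI)
  fix x :: real assume x: "x \<in> {0..1}"
  show "x \<in> h ` itineraries"
  proof (cases "x = 1")
    case True
    then have "x = h (\<lambda>_. R)" by (simp add: h_eq_1_iff)
    then show ?thesis by (auto simp: itineraries_def)
  next
    case False
    with x have "0 \<le> x" "x < 1" by auto
    then show ?thesis using h_binary_itinerary binary_itinerary_in by (metis image_eqI)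
  qed
qed (auto simp: h_nonneg h_le_1)

section \<open>Comparison of the topologies\<close>

lemma Metric_space_dstar: "Metric_space {0..1} dstar"
proof
  fix x y z :: real
  show "0 \<le> dstar x y" by (simp add: dstar_def ell_nonneg)
  show "dstar x y = dstar y x" by (simp add: dstar_def ell_commute)
  show "dstar x y = 0 \<longleftrightarrow> x = y" if "x \<in> {0..1}" "y \<in> {0..1}"
    using that bij_betw_h unfolding dstar_def ell_eq_0_iff
    by (metis bij_betw_inv_into_right)
  have "max (dstar x y) (dstar y z) \<le> dstar x y + dstar y z"
    by (simp add: dstar_def ell_nonneg)
  then show "dstar x z \<le> dstar x y + dstar y z"
    using ell_ultrametric unfolding dstar_def by (meson order_trans)
qed

lemma dist_le_dstar:
  assumes "x \<in> {0..1}" "y \<in> {0..1}"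
  shows "\<bar>x - y\<bar> \<le> dstar x y"
  using h_dist_le_ell[of "inv_into itineraries h x" "inv_into itineraries h y"]
    bij_betw_inv_into_right[OF bij_betw_h] assms by (simp add: dstar_def)

text \<open>A larger metric has smaller balls, so the same radius witnesses openness.\<close>

lemma openin_mtopology_mono:
  assumes "Metric_space X d" "Metric_space X d'"
    and le: "\<And>x y. x \<in> X \<Longrightarrow> y \<in> X \<Longrightarrow> d x y \<le> d' x y"
    and U: "openin (Metric_space.mtopology X d) U"
  shows "openin (Metric_space.mtopology X d') U"
proof -
  interpret d: Metric_space X d by fact
  interpret d': Metric_space X d' by fact
  have "d'.mball x r \<subseteq> d.mball x r" for x r
    using le by (force simp: d.mball_def d'.mball_def)
  then show ?thesis
    using U unfolding d.openin_mtopology d'.openin_mtopology by (meson order_trans)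
qed

text \<open>Distance at most 1/2 already forces equal first symbols, so radius 1/2 works at every
  point.\<close>

lemma openin_first_symbol:
  "openin (Metric_space.mtopology {0..1} dstar) {x \<in> {0..1}. inv_into itineraries h x 0 = c}"
proof -
  interpret Metric_space "{0..1}" dstar by (rule Metric_space_dstar)
  have "inv_into itineraries h x 0 = inv_into itineraries h y 0" if "dstar x y < 1 / 2 ^ 1" for x y
    using ell_le_iff[where n = 1] that unfolding dstar_def by (metis less_imp_le zero_less_one)
  then have "mball x (1 / 2 ^ 1) \<subseteq> {x \<in> {0..1}. inv_into itineraries h x 0 = c}"
    if "inv_into itineraries h x 0 = c" for x
    using that by fastforce
  then show ?thesis
    unfolding openin_mtopology by (fastforce intro: exI[of _ "1 / 2 ^ 1 :: real"])
qed

lemma inv_into_h_eq: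
  assumes "s \<in> itineraries"
  shows "inv_into itineraries h (h s) = s"
  using assms by (rule inv_into_f_f[OF inj_on_h])

lemma Metric_space_abs_diff: "Metric_space X (\<lambda>x y::real. \<bar>x - y\<bar>)"
  by unfold_locales auto

text \<open>Transfers compactness and connectedness of the real interval to the abstract metric
  topology.\<close>

lemma mtopology_abs_diff:
  "Metric_space.mtopology X (\<lambda>x y::real. \<bar>x - y\<bar>) = top_of_set X"
proof -
  interpret Submetric UNIV dist X
    by unfold_locales simp
  show ?thesis
    using mtopology_submetric unfolding mtopology_is_euclidean by (simp add: dist_real_def[abs_def])
qed

lemma continuum_unit_interval: "continuum {0..1} (\<lambda>x y::real. \<bar>x - y\<bar>)"
  unfolding continuum_def mtopology_abs_diff
proof (intro conjI)
  show "compact_space (top_of_set {0..1::real})"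
    by (simp add: compact_space_subtopology)
  show "connected_space (top_of_set {0..1::real})"
    by (rule connected_space_subtopology)
      (simp only: connectedin_iff_connected connected_Icc)
  show "uncountable {0..1::real}"
    by (simp add: uncountable_closed_interval)
qed (rule Metric_space_abs_diff)

theorem theorem2: "ultracontinuum {0..1::real} dstar (\<lambda>x y. \<bar>x - y\<bar>)"
proof -
  let ?E = "Metric_space.mtopology {0..1} (\<lambda>x y::real. \<bar>x - y\<bar>)"
  let ?D = "Metric_space.mtopology {0..1} dstar"
  have finer: "openin ?D U" if "openin ?E U" for U
    using Metric_space_abs_diff Metric_space_dstar dist_le_dstar that
    by (rule openin_mtopology_mono)
  \<comment> \<open>\<open>A L\<close> is [0,1/2) and \<open>A R\<close> is [1/2,1].\<close>
  define A where "A c = {x \<in> {0..1}. inv_into itineraries h x 0 = c}" for c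
  have open_A: "openin ?D (A c)" for c
    unfolding A_def by (rule openin_first_symbol)
  have A_nonempty: "A c \<noteq> {}" for c
  proof -
    \<comment> \<open>The constant sequences code the endpoints 0 and 1, one in each half.\<close>
    have s: "(\<lambda>_. c) \<in> itineraries" by (cases c) (auto simp: itineraries_def)
    then have "h (\<lambda>_. c) \<in> A c"
      by (simp add: A_def inv_into_h_eq h_nonneg h_le_1)
    then show ?thesis by blast
  qed
  have "x \<in> A L \<union> A R" if "x \<in> {0..1}" for x
    using that unfolding A_def by (cases "inv_into itineraries h x 0") simp_all
  then have A_cover: "topspace ?E \<subseteq> A L \<union> A R"
    unfolding mtopology_abs_diff topspace_euclidean_subtopology by (rule subsetI)
  have A_disjoint: "A L \<inter> A R = {}" by (auto simp: A_def)
  have "connected_space ?E"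
    using continuum_unit_interval by (simp only: continuum_def)
  then have "\<not> (openin ?E (A L) \<and> openin ?E (A R))"
    using connected_spaceD[OF _ _ _ A_cover A_disjoint A_nonempty A_nonempty] by blast
  then have "{U. openin ?E U} \<noteq> {U. openin ?D U}"
    using open_A by (metis mem_Collect_eq)
  then have "{U. openin ?E U} \<subset> {U. openin ?D U}"
    using finer by (intro psubsetI Collect_mono) simp_all
  then show ?thesis
    unfolding ultracontinuum_def
    by (intro conjI continuum_unit_interval Metric_space_dstar)
qed

end
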